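(* Let $\alpha\in(1/2,1)$ and let $f$ satisfy: $f:\mathbb{R}\to\mathbb{R}$ is continuous, $f\ge 0$ on $\mathbb{R}$, $\operatorname{supp} f=[\theta,1]$ for some $\theta\in(0,1)$, and $f'(1)<0$. Let $(\phi_0,c_0)$ be the unique solution of $$(-\partial_{xx})^\alpha\phi_0+c_0\,\phi_0'=f(\phi_0)\ \text{ on }\mathbb{R},\qquad \lim_{x\to-\infty}\phi_0=0,\quad \lim_{x\to+\infty}\phi_0=1,\quad \phi_0(0)=\theta.$$ Then there exist constants $m,M>0$ such that $$\phi_0(x)\le \frac{M}{|x|^{2\alpha-1}}\quad\text{and}\quad \phi_0'(x)\ge\frac{m}{|x|^{2\alpha}}\qquad\text{for all }x\le -1.$$
   Context: The fractional Laplacian is $(-\partial_{xx})^\alpha u(x)=c_\alpha\,\mathrm{PV}\!\int_{\mathbb{R}}\frac{u(x)-u(z)}{|x-z|^{1+2\alpha}}\,dz$, with $c_\alpha>0$ the standard normalizing constant (Fourier symbol $|\xi|^{2\alpha}$). Existence and uniqueness of $(\phi_0,c_0)$ (with $c_0>0$ and $\phi_0$ increasing) is known under these hypotheses.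
   Formalization: The hypothesis f'(1)<0 is taken as a negative left derivative of f at 1, because f≥0 with supp f=[θ,1] makes f vanish at 1 and beyond, so a two-sided derivative at 1 could only be 0. *)

theory Defs
  imports "HOL-Analysis.Analysis"
begin

text \<open>Normalizing constant of the 1D fractional Laplacian with Fourier symbol
  |xi|^(2 alpha):  c = 4^alpha Gamma(1/2+alpha) / (sqrt pi * |Gamma(-alpha)|).\<close>
definition frac_const :: "real \<Rightarrow> real" where
  "frac_const \<alpha> = 4 powr \<alpha> * Gamma (1/2 + \<alpha>) / (sqrt pi * \<bar>Gamma (- \<alpha>)\<bar>)"

definition frac_integrand :: "real \<Rightarrow> (real \<Rightarrow> real) \<Rightarrow> real \<Rightarrow> real \<Rightarrow> real \<Rightarrow> real" where
  "frac_integrand \<alpha> u x \<epsilon> z =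
     indicator {z. \<epsilon> < \<bar>x - z\<bar>} z * ((u x - u z) / \<bar>x - z\<bar> powr (1 + 2 * \<alpha>))"

definition has_frac_lap :: "real \<Rightarrow> (real \<Rightarrow> real) \<Rightarrow> real \<Rightarrow> real \<Rightarrow> bool" where
  "has_frac_lap \<alpha> u x L \<longleftrightarrow>
     (\<forall>\<epsilon>>0. integrable lborel (frac_integrand \<alpha> u x \<epsilon>)) \<and>
     ((\<lambda>\<epsilon>. frac_const \<alpha> * (LINT z|lborel. frac_integrand \<alpha> u x \<epsilon> z)) \<longlongrightarrow> L) (at_right 0)"

end

theory Submission
  imports Defs
begin

text \<open>
  Since \<open>f\<close> vanishes on \<open>{..\<theta>}\<close> and \<open>\<phi>0\<close> is increasing, \<open>u = \<phi>0\<close> solves the linear equation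
  \<open>L u + c0 u' = 0\<close> on the negative half-line, where \<open>L\<close> is the fractional Laplacian. Both bounds
  follow by comparison with explicit barriers at a point where the difference is extremal; there
  only one-sided bounds on second differences are needed, so no regularity of \<open>u\<close> beyond
  differentiability enters. Write \<open>y = - x\<close> and \<open>s = 2\<alpha> \<in> (1,2)\<close>.

  Upper bound: \<open>min 1 (M y powr (1 - s))\<close> is a strict supersolution for large \<open>M\<close>, because the drift
  contributes \<open>c0 M (s - 1) y powr (- s)\<close> while the nonlocal term is at worst of order
  \<open>y powr (- s)\<close> with a constant independent of \<open>M\<close>.

  Lower bound: the difference quotients \<open>v\<close> of \<open>u\<close> solve the same equation. The positive part of
  \<open>m (y powr (- s) - a y powr (- 2))\<close> produces an error of order \<open>m y powr (- 1 - s)\<close>, whereas the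
  mass of \<open>v\<close> on a fixed interval \<open>{0..T}\<close>, bounded below uniformly in the step size, contributes
  a gain of order \<open>y powr (- 1 - s)\<close>. For small \<open>m\<close> the gain wins; then the step tends to zero.
\<close>

section \<open>Integrals of powers of \<bar>t\<bar> near the origin and near infinity\<close>

lemma has_bochner_integral_lborel_of_has_integral:
  fixes f :: "real \<Rightarrow> real"
  assumes "f \<in> borel_measurable borel" "\<And>x. 0 \<le> f x" "(f has_integral I) UNIV"
  shows "has_bochner_integral lborel f I"
proof (rule has_bochner_integral_nn_integral)
  show "0 \<le> I" using assms has_integral_nonneg by blast
  show "integral\<^sup>N lborel f = ennreal I"
    using nn_integral_has_integral_lborel[OF assms] .
qed (use assms in auto)

lemma has_bochner_integral_abs_powr_near:
  fixes a r :: real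
  assumes "-1 < a" "0 \<le> r"
  shows "has_bochner_integral lborel (\<lambda>t. indicator {-r..r} t * \<bar>t\<bar> powr a) (2 * (r powr (a + 1) / (a + 1)))"
proof -
  have "((\<lambda>t. indicator {0..r} t * t powr a) has_integral r powr (a+1) / (a+1)) UNIV"
    using has_integral_powr_from_0[OF assms]
    unfolding has_integral_restrict_UNIV[of "{0..r}", symmetric]
    by (rule has_integral_eq[rotated]) (simp add: indicator_def)
  then have "has_bochner_integral lborel (\<lambda>t. indicator {0..r} t * t powr a) (r powr (a+1) / (a+1))"
    by (intro has_bochner_integral_lborel_of_has_integral) auto
  also have "(\<lambda>t. indicator {0..r} t * t powr a) =
      (\<lambda>t. indicator {0..} t *\<^sub>R (indicator {-r..r} t * \<bar>t\<bar> powr a))"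
    using assms by (auto simp: indicator_def fun_eq_iff)
  finally have "has_bochner_integral lborel (\<lambda>t. indicator {-r..r} t * \<bar>t\<bar> powr a) (2 *\<^sub>R (r powr (a + 1) / (a + 1)))"
    by (rule has_bochner_integral_even_function) (auto simp: indicator_def)
  then show ?thesis by simp
qed

lemma has_bochner_integral_abs_powr_far:
  fixes a r :: real
  assumes "a < -1" "0 < r"
  shows "has_bochner_integral lborel (\<lambda>t. indicator {t. r \<le> \<bar>t\<bar>} t * \<bar>t\<bar> powr a) (2 * (- (r powr (a + 1)) / (a + 1)))"
proof -
  have "((\<lambda>t. indicator {r..} t * t powr a) has_integral - (r powr (a+1)) / (a+1)) UNIV"
    using has_integral_powr_to_inf[OF assms]
    unfolding has_integral_restrict_UNIV[of "{r..}", symmetric]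
    by (rule has_integral_eq[rotated]) (simp add: indicator_def)
  then have "has_bochner_integral lborel (\<lambda>t. indicator {r..} t * t powr a) (- (r powr (a+1)) / (a+1))"
    by (intro has_bochner_integral_lborel_of_has_integral) auto
  also have "(\<lambda>t. indicator {r..} t * t powr a) =
      (\<lambda>t. indicator {0..} t *\<^sub>R (indicator {t. r \<le> \<bar>t\<bar>} t * \<bar>t\<bar> powr a))"
    using assms by (auto simp: indicator_def fun_eq_iff)
  finally have "has_bochner_integral lborel (\<lambda>t. indicator {t. r \<le> \<bar>t\<bar>} t * \<bar>t\<bar> powr a) (2 *\<^sub>R (- (r powr (a + 1)) / (a + 1)))"
    by (rule has_bochner_integral_even_function) (auto simp: indicator_def)
  then show ?thesis by simp
qed

section \<open>The normalizing constant and the maximum principle\<close>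

lemma frac_const_pos:
  assumes "0 < \<alpha>" "\<alpha> < 1"
  shows "0 < frac_const \<alpha>"
proof -
  \<comment> \<open>\<open>Gamma\<close> is 0 exactly at the nonpositive integers, its poles
    receiving that default value, so this excludes a vanishing denominator.\<close>
  have "- \<alpha> \<notin> \<int>\<^sub>\<le>\<^sub>0"
  proof
    assume "- \<alpha> \<in> \<int>\<^sub>\<le>\<^sub>0"
    then obtain n :: int where "- \<alpha> = of_int n" by (elim nonpos_Ints_cases)
    with assms have "real_of_int (-1) < of_int n" "real_of_int n < of_int 0" by simp_all
    then show False unfolding of_int_less_iff by linarith
  qed
  then have "Gamma (- \<alpha>) \<noteq> 0" by (simp add: Gamma_eq_zero_iff)
  moreover have "0 < Gamma (1/2 + \<alpha>)" using assms by (intro Gamma_real_pos) simp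
  ultimately show ?thesis unfolding frac_const_def by simp
qed

text \<open>Quantitative maximum principle. Pairing the points \<open>x + t\<close> and \<open>x - t\<close> turns the
  principal value into an integral of second differences, so only one-sided bounds are needed.
  The nonnegative function \<open>E\<close> records an additional gain coming from far away.\<close>

lemma frac_lap_lower_bound:
  fixes \<alpha> x L A D r \<rho> :: real and w E :: "real \<Rightarrow> real"
  assumes \<alpha>: "0 < \<alpha>" "\<alpha> < 1"
    and lap: "has_frac_lap \<alpha> w x L"
    and pos: "0 < r" "0 \<le> A" "0 \<le> D"
    and near: "\<And>t. 0 < t \<Longrightarrow> t < r \<Longrightarrow> w (x + t) + w (x - t) - 2 * w x \<le> A * t\<^sup>2"
    and far: "\<And>z. r \<le> \<bar>z - x\<bar> \<Longrightarrow> w z - w x \<le> D - E z"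
    and E_int: "integrable lborel E"
    and E_nonneg: "\<And>z. 0 \<le> E z"
    and E_supp: "\<And>z. E z \<noteq> 0 \<Longrightarrow> r \<le> \<bar>z - x\<bar> \<and> \<bar>z - x\<bar> \<le> \<rho>"
  shows "frac_const \<alpha> * (\<rho> powr (- 1 - 2 * \<alpha>) * (LINT z|lborel. E z)
      - A * (r powr (2 - 2 * \<alpha>) / (2 - 2 * \<alpha>)) - D * (2 * r powr (- 2 * \<alpha>) / (2 * \<alpha>))) \<le> L"
    (is "_ * ?X \<le> L")
proof -
  \<comment> \<open>\<open>N\<close> is the kernel times the factor t squared from the bound on
    second differences, \<open>F\<close> is the bare kernel away from the origin, and
    \<open>K\<close> is a lower bound for the kernel on the support of \<open>E\<close>.\<close>
  define N where "N = (\<lambda>t::real. indicator {-r..r} t * \<bar>t\<bar> powr (1 - 2 * \<alpha>))"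
  define F where "F = (\<lambda>t::real. indicator {t. r \<le> \<bar>t\<bar>} t * \<bar>t\<bar> powr (- 1 - 2 * \<alpha>))"
  define K where "K = \<rho> powr (- 1 - 2 * \<alpha>)"
  define Q where "Q = (LINT z|lborel. E z)"
  have N: "has_bochner_integral lborel N (2 * (r powr (2 - 2 * \<alpha>) / (2 - 2 * \<alpha>)))"
    using has_bochner_integral_abs_powr_near[of "1 - 2 * \<alpha>" r] \<alpha> pos by (simp add: N_def)
  have F: "has_bochner_integral lborel F (2 * (r powr (- 2 * \<alpha>) / (2 * \<alpha>)))"
    using has_bochner_integral_abs_powr_far[of "- 1 - 2 * \<alpha>" r] \<alpha> pos by (simp add: F_def)
  have E1: "has_bochner_integral lborel (\<lambda>t. E (x + t)) Q"
    using lborel_integrable_real_affine[OF E_int, of 1 x] lborel_integral_real_affine[of 1 E x]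
    by (simp add: has_bochner_integral_iff Q_def)
  have E2: "has_bochner_integral lborel (\<lambda>t. E (x - t)) Q"
    using lborel_integrable_real_affine[OF E_int, of "-1" x] lborel_integral_real_affine[of "-1" E x]
    by (simp add: has_bochner_integral_iff Q_def)
  \<comment> \<open>This minorant of the paired integrand does not depend on the cutoff
    \<open>\<epsilon>\<close>. Integrating over all real \<open>t\<close> counts each pair twice,
    whence the factor 2 in front of \<open>?X\<close>.\<close>
  define H where "H = (\<lambda>t. K * (E (x + t) + E (x - t)) - (A * N t + (2 * D) * F t))"
  have H: "has_bochner_integral lborel H (2 * ?X)"
  proof -
    have "has_bochner_integral lborel H (K * (Q + Q)
       - (A * (2 * (r powr (2 - 2 * \<alpha>) / (2 - 2 * \<alpha>))) + (2 * D) * (2 * (r powr (- 2 * \<alpha>) / (2 * \<alpha>)))))"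
      unfolding H_def
      by (intro has_bochner_integral_diff has_bochner_integral_add has_bochner_integral_mult_right E1 E2 N F)
    also have "(K * (Q + Q)
       - (A * (2 * (r powr (2 - 2 * \<alpha>) / (2 - 2 * \<alpha>))) + (2 * D) * (2 * (r powr (- 2 * \<alpha>) / (2 * \<alpha>))))) = 2 * ?X"
      unfolding K_def Q_def by (simp add: algebra_simps)
    finally show ?thesis .
  qed
  have bound: "?X \<le> (LINT z|lborel. frac_integrand \<alpha> w x \<epsilon> z)" if \<epsilon>: "0 < \<epsilon>" "\<epsilon> < r" for \<epsilon>
  proof -
    define J where "J = frac_integrand \<alpha> w x \<epsilon>"
    have J: "integrable lborel J" using lap \<epsilon> by (simp add: has_frac_lap_def J_def)
    have J1: "has_bochner_integral lborel (\<lambda>t. J (x + t)) (integral\<^sup>L lborel J)"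
      using lborel_integrable_real_affine[OF J, of 1 x] lborel_integral_real_affine[of 1 J x]
      by (simp add: has_bochner_integral_iff)
    have J2: "has_bochner_integral lborel (\<lambda>t. J (x - t)) (integral\<^sup>L lborel J)"
      using lborel_integrable_real_affine[OF J, of "-1" x] lborel_integral_real_affine[of "-1" J x]
      by (simp add: has_bochner_integral_iff)
    have JJ: "has_bochner_integral lborel (\<lambda>t. J (x + t) + J (x - t)) (2 * integral\<^sup>L lborel J)"
      using has_bochner_integral_add[OF J1 J2] by simp
    have J_eq: "J (x + t) + J (x - t) =
        indicator {t. \<epsilon> < \<bar>t\<bar>} t * ((2 * w x - w (x + t) - w (x - t)) * \<bar>t\<bar> powr (- 1 - 2 * \<alpha>))" for t
    proof -
      have "\<bar>t\<bar> powr (- 1 - 2 * \<alpha>) = 1 / \<bar>t\<bar> powr (1 + 2 * \<alpha>)"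
        using powr_minus_divide[of "\<bar>t\<bar>" "1 + 2 * \<alpha>"] by simp
      then show ?thesis
        by (simp add: J_def frac_integrand_def indicator_def diff_divide_distrib[symmetric] add_divide_distrib[symmetric])
    qed
    have E0: "E (x + t) = 0" "E (x - t) = 0" if "\<bar>t\<bar> < r" for t
      using E_supp[of "x + t"] E_supp[of "x - t"] that by auto
    have le: "H t \<le> J (x + t) + J (x - t)" for t
    proof -
      consider "\<bar>t\<bar> \<le> \<epsilon>" | "\<epsilon> < \<bar>t\<bar>" "\<bar>t\<bar> < r" | "r \<le> \<bar>t\<bar>" by linarith
      then show ?thesis
      proof cases
        case 1
        have "0 \<le> A * N t" "0 \<le> 2 * D * F t" using pos by (simp_all add: N_def F_def)
        with 1 \<epsilon> show ?thesis by (simp add: H_def J_eq E0)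
      next
        case 2
        then have t: "\<bar>t\<bar> > 0" using \<epsilon> by simp
        have "w (x + \<bar>t\<bar>) + w (x - \<bar>t\<bar>) = w (x + t) + w (x - t)"
          by (cases "t \<ge> 0") auto
        with near[of "\<bar>t\<bar>"] t 2
        have "- (A * t\<^sup>2) \<le> 2 * w x - w (x + t) - w (x - t)" by simp
        then have "- (A * t\<^sup>2) * \<bar>t\<bar> powr (- 1 - 2 * \<alpha>)
            \<le> (2 * w x - w (x + t) - w (x - t)) * \<bar>t\<bar> powr (- 1 - 2 * \<alpha>)"
          by (rule mult_right_mono) simp
        moreover have "t\<^sup>2 * \<bar>t\<bar> powr (- 1 - 2 * \<alpha>) = N t"
        proof -
          have "t\<^sup>2 = \<bar>t\<bar> powr 2" using t by simp
          then have "t\<^sup>2 * \<bar>t\<bar> powr (- 1 - 2 * \<alpha>) = \<bar>t\<bar> powr (1 - 2 * \<alpha>)"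
            using powr_add[of "\<bar>t\<bar>" 2 "- 1 - 2 * \<alpha>"] by simp
          with 2 show ?thesis by (auto simp: N_def indicator_def)
        qed
        moreover have "F t = 0" using 2 by (simp add: F_def)
        ultimately show ?thesis using 2 by (simp add: H_def J_eq E0 mult.assoc)
      next
        case 3
        have *: "- 2 * D + (E (x + t) + E (x - t)) \<le> 2 * w x - w (x + t) - w (x - t)"
          using far[of "x + t"] far[of "x - t"] 3 by simp
        have F: "F t = \<bar>t\<bar> powr (- 1 - 2 * \<alpha>)" using 3 by (simp add: F_def)
        \<comment> \<open>The kernel decreases with the distance, so on the support of
          \<open>E\<close> it is at least its value \<open>K\<close> at distance
          \<open>\<rho>\<close>.\<close>
        have "K * E z \<le> F t * E z" if "z = x + t \<or> z = x - t" for z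
        proof (cases "E z = 0")
          case False
          then have "\<bar>t\<bar> \<le> \<rho>" using E_supp[of z] that by auto
          then have "K \<le> F t" unfolding F K_def
            using 3 pos \<alpha> by (intro powr_mono2') auto
          then show ?thesis using E_nonneg by (rule mult_right_mono)
        qed simp
        then have "K * (E (x + t) + E (x - t)) \<le> F t * (E (x + t) + E (x - t))"
          by (simp add: distrib_left add_mono)
        also have "F t * (E (x + t) + E (x - t)) - 2 * D * F t
            \<le> (2 * w x - w (x + t) - w (x - t)) * F t"
          using mult_right_mono[OF *, of "F t"] F by (simp add: algebra_simps)
        \<comment> \<open>At \<open>\<bar>t\<bar> = r\<close> both weights are present; the extra
          \<open>N\<close> only lowers the minorant.\<close>
        moreover have "0 \<le> A * N t" using pos by (simp add: N_def)
        ultimately show ?thesis using 3 \<epsilon> by (simp add: H_def J_eq F)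
      qed
    qed
    have "integral\<^sup>L lborel H \<le> integral\<^sup>L lborel (\<lambda>t. J (x + t) + J (x - t))"
      using H JJ le by (intro integral_mono) (auto simp: has_bochner_integral_iff)
    then show ?thesis using H JJ by (simp add: has_bochner_integral_iff J_def)
  qed
  show ?thesis
  proof (rule tendsto_lowerbound)
    show "((\<lambda>\<epsilon>. frac_const \<alpha> * (LINT z|lborel. frac_integrand \<alpha> w x \<epsilon> z)) \<longlongrightarrow> L) (at_right 0)"
      using lap by (simp add: has_frac_lap_def)
    have "eventually (\<lambda>\<epsilon>. 0 < \<epsilon> \<and> \<epsilon> < r) (at_right 0)"
      using pos(1) by (auto simp: eventually_at_right_field)
    then show "eventually (\<lambda>\<epsilon>. frac_const \<alpha> * ?X \<le> frac_const \<alpha> * (LINT z|lborel. frac_integrand \<alpha> w x \<epsilon> z)) (at_right 0)"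
      by eventually_elim (use bound frac_const_pos[OF \<alpha>] in \<open>auto intro!: mult_left_mono\<close>)
  qed simp
qed

section \<open>Second differences of negative powers\<close>

lemma powr_le_linear:
  fixes x p :: real
  assumes "0 < x" "0 \<le> p" "p \<le> 1"
  shows "x powr p \<le> 1 + p * (x - 1)"
  \<comment> \<open>Weighted arithmetic-geometric mean inequality for \<open>x\<close> and 1; the
    right-hand side is the tangent at 1 of the concave power.\<close>
  using Youngs_inequality_0[of p "1 - p" x 1] assms by (simp add: algebra_simps)

text \<open>After scaling by \<open>y\<close>, the tangent bound for concave powers reduces the
  claim to exponent one. There the second difference is
  \<open>2 * \<tau>\<^sup>2 / (1 - \<tau>\<^sup>2)\<close>, and \<open>\<tau> < 1/2\<close> gives
  the factor 8/3, rounded up to 3.\<close>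

lemma powr_neg_second_difference_le:
  fixes y t p :: real
  assumes "0 < t" "t < y / 2" "0 \<le> p" "p \<le> 1"
  shows "(y - t) powr (- p) + (y + t) powr (- p) - 2 * y powr (- p) \<le> 3 * y powr (- p) * (t / y)\<^sup>2"
proof -
  define \<tau> where "\<tau> = t / y"
  have y: "0 < y" using assms by simp
  have \<tau>: "0 < \<tau>" "\<tau> < 1/2" using assms y by (simp_all add: \<tau>_def field_simps)
  have split: "(y * (1 + a)) powr (- p) = y powr (- p) * inverse (1 + a) powr p" if "-1 < a" for a
    using y that by (simp add: powr_mult powr_minus inverse_powr)
  have m: "y - t = y * (1 + - \<tau>)" and q: "y + t = y * (1 + \<tau>)"
    using y by (simp_all add: \<tau>_def field_simps)
  have "inverse (1 + - \<tau>) powr p + inverse (1 + \<tau>) powr p - 2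
      \<le> p * (inverse (1 + - \<tau>) + inverse (1 + \<tau>) - 2)"
    using powr_le_linear[of "inverse (1 + - \<tau>)" p] powr_le_linear[of "inverse (1 + \<tau>)" p] assms \<tau>
    by (simp add: algebra_simps)
  also have "\<dots> \<le> 3 * \<tau>\<^sup>2"
  proof -
    have sq: "\<tau>\<^sup>2 \<le> 1/4" using power_mono[of \<tau> "1/2" 2] \<tau> by (simp add: power2_eq_square)
    have "inverse (1 + - \<tau>) + inverse (1 + \<tau>) - 2 = 2 * \<tau>\<^sup>2 / (1 - \<tau>\<^sup>2)"
    proof -
      have eq: "1 - \<tau>\<^sup>2 = (1 + - \<tau>) * (1 + \<tau>)" by (simp add: algebra_simps power2_eq_square)
      have "inverse (1 + - \<tau>) = (1 + \<tau>) / (1 - \<tau>\<^sup>2)" "inverse (1 + \<tau>) = (1 - \<tau>) / (1 - \<tau>\<^sup>2)"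
        unfolding eq using \<tau> by (simp_all add: inverse_eq_divide)
      then have "inverse (1 + - \<tau>) + inverse (1 + \<tau>) = 2 / (1 - \<tau>\<^sup>2)"
        by (simp add: add_divide_distrib[symmetric])
      then show ?thesis using sq by (simp add: field_simps)
    qed
    moreover have "p * (2 * \<tau>\<^sup>2 / (1 - \<tau>\<^sup>2)) \<le> 1 * (2 * \<tau>\<^sup>2 / (1 - \<tau>\<^sup>2))"
      using assms sq by (intro mult_right_mono) auto
    moreover have "2 * \<tau>\<^sup>2 / (1 - \<tau>\<^sup>2) \<le> 3 * \<tau>\<^sup>2"
    proof -
      have "2 * \<tau>\<^sup>2 \<le> 3 * \<tau>\<^sup>2 * (1 - \<tau>\<^sup>2)"
        using mult_left_mono[of "2/3" "1 - \<tau>\<^sup>2" "3 * \<tau>\<^sup>2"] sq by simp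
      then show ?thesis using sq by (simp add: pos_divide_le_eq)
    qed
    ultimately show ?thesis by simp
  qed
  finally have "y powr (- p) * (inverse (1 + - \<tau>) powr p + inverse (1 + \<tau>) powr p - 2) \<le> y powr (- p) * (3 * \<tau>\<^sup>2)"
    by (rule mult_left_mono) simp
  moreover have "(y - t) powr (- p) = y powr (- p) * inverse (1 + - \<tau>) powr p"
    "(y + t) powr (- p) = y powr (- p) * inverse (1 + \<tau>) powr p"
    unfolding m q using \<tau> by (intro split; simp)+
  ultimately show ?thesis unfolding \<tau>_def[symmetric] by (simp add: algebra_simps)
qed

text \<open>Convexity: the arithmetic-geometric mean inequality compares the sum with the power of
  the geometric mean of \<open>y - t\<close> and \<open>y + t\<close>, and that mean is at most
  \<open>y\<close>.\<close>

lemma powr_neg_second_difference_nonneg: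
  fixes y t p :: real
  assumes "0 < t" "t < y" "0 \<le> p"
  shows "2 * y powr (- p) \<le> (y - t) powr (- p) + (y + t) powr (- p)"
proof -
  have "2 * (exp (- p * ((ln (y - t) + ln (y + t)) / 2))) \<le> exp (- p * ln (y - t)) + exp (- p * ln (y + t))"
  proof -
    define a b where "a = exp (- p * ln (y - t) / 2)" and "b = exp (- p * ln (y + t) / 2)"
    have "exp (- p * ln (y - t)) = a * a" "exp (- p * ln (y + t)) = b * b"
      "exp (- p * ((ln (y - t) + ln (y + t)) / 2)) = a * b"
      unfolding a_def b_def exp_add[symmetric] by (simp_all add: field_simps)
    then show ?thesis using sum_squares_bound[of a b] by (simp add: power2_eq_square)
  qed
  moreover have "exp (- p * ln y) \<le> exp (- p * ((ln (y - t) + ln (y + t)) / 2))"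
  proof -
    have "ln (y - t) + ln (y + t) = ln ((y - t) * (y + t))"
      using assms by (simp add: ln_mult)
    also have "\<dots> \<le> ln (y * y)"
      using assms by (intro ln_mono) (auto simp: algebra_simps mult_strict_mono)
    also have "\<dots> = 2 * ln y" using assms by (simp add: ln_mult)
    finally have "p * ((ln (y - t) + ln (y + t)) / 2) \<le> p * ln y"
      using assms by (intro mult_left_mono) auto
    then show ?thesis by simp
  qed
  ultimately have "2 * exp (- p * ln y) \<le> exp (- p * ln (y - t)) + exp (- p * ln (y + t))"
    by linarith
  then show ?thesis using assms by (simp add: powr_def)
qed

text \<open>After scaling by \<open>y\<close>, with \<open>q = \<tau>\<^sup>2\<close>, the sum is
  exactly \<open>(2 + 2 * q) / (1 - q)\<^sup>2\<close>. Clearing denominators with the constant 11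
  leaves \<open>q * (5 - 20 * q + 11 * q\<^sup>2)\<close>, nonnegative because
  \<open>q \<le> 1/4\<close>.\<close>

lemma inverse_square_second_difference_le:
  fixes y t :: real
  assumes "0 < t" "t < y / 2"
  shows "1 / (y - t)\<^sup>2 + 1 / (y + t)\<^sup>2 - 2 / y\<^sup>2 \<le> 11 / y ^ 4 * t\<^sup>2"
proof -
  define \<tau> where "\<tau> = t / y"
  have y: "0 < y" using assms by simp
  have \<tau>: "0 < \<tau>" "\<tau> < 1/2" using assms y by (simp_all add: \<tau>_def field_simps)
  define q where "q = \<tau>\<^sup>2"
  have q: "0 \<le> q" "q \<le> 1/4"
    using power_mono[of \<tau> "1/2" 2] \<tau> by (simp_all add: q_def power2_eq_square)
  have "1 / (1 - \<tau>)\<^sup>2 + 1 / (1 + \<tau>)\<^sup>2 = (2 + 2 * q) / (1 - q)\<^sup>2"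
  proof -
    have "(1 - q)\<^sup>2 = (1 - \<tau>)\<^sup>2 * (1 + \<tau>)\<^sup>2"
      by (simp add: q_def power2_eq_square algebra_simps)
    then show ?thesis using \<tau> by (simp add: add_frac_eq) (simp add: q_def power2_eq_square algebra_simps)
  qed
  also have "\<dots> \<le> 2 + 11 * q"
  proof -
    have "0 \<le> q * (5 - 20 * q + 11 * q\<^sup>2)"
      using q by (intro mult_nonneg_nonneg) (auto intro: add_nonneg_nonneg)
    then have "2 + 2 * q \<le> (2 + 11 * q) * (1 - q)\<^sup>2"
      by (simp add: power2_eq_square algebra_simps)
    then show ?thesis using q by (simp add: pos_divide_le_eq)
  qed
  finally have *: "1 / (1 - \<tau>)\<^sup>2 + 1 / (1 + \<tau>)\<^sup>2 - 2 \<le> 11 * q" by simp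
  have m: "y - t = y * (1 - \<tau>)" and p: "y + t = y * (1 + \<tau>)"
    using y by (simp_all add: \<tau>_def field_simps)
  have "1 / (y - t)\<^sup>2 + 1 / (y + t)\<^sup>2 - 2 / y\<^sup>2 = (1 / (1 - \<tau>)\<^sup>2 + 1 / (1 + \<tau>)\<^sup>2 - 2) / y\<^sup>2"
    unfolding m p by (simp add: power_mult_distrib diff_divide_distrib add_divide_distrib mult.commute)
  also have "\<dots> \<le> 11 * q / y\<^sup>2" using * by (rule divide_right_mono) simp
  also have "\<dots> = 11 / y ^ 4 * t\<^sup>2"
    using y by (simp add: q_def \<tau>_def power_divide power2_eq_square eval_nat_numeral)
  finally show ?thesis .
qed

section \<open>Derivatives, translations and maxima on the half-line\<close>

lemma has_real_derivative_powr_reflected: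
  fixes x p :: real
  assumes "x < 0"
  shows "((\<lambda>x. (- x) powr p) has_real_derivative - p * (- x) powr (p - 1)) (at x)"
  using assms by (auto intro!: derivative_eq_intros simp: field_simps)

text \<open>Linearity and translation invariance hold already for the truncated integrals and pass
  to the limit. With \<open>k = 1 / h\<close> the function is minus the difference quotient of
  \<open>u\<close>, the sign that the lower barrier requires.\<close>

lemma has_frac_lap_shift_diff:
  assumes "has_frac_lap \<alpha> u x L0" "has_frac_lap \<alpha> u (x + h) L1"
  shows "has_frac_lap \<alpha> (\<lambda>z. k * (u z - u (z + h))) x (k * (L0 - L1))"
proof -
  have eq: "frac_integrand \<alpha> (\<lambda>z. k * (u z - u (z + h))) x \<epsilon> z =
      k * (frac_integrand \<alpha> u x \<epsilon> z - frac_integrand \<alpha> u (x + h) \<epsilon> (h + 1 * z))" for \<epsilon> z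
    by (simp add: frac_integrand_def indicator_def algebra_simps diff_divide_distrib add_divide_distrib)
  have I0: "integrable lborel (frac_integrand \<alpha> u x \<epsilon>)" if "0 < \<epsilon>" for \<epsilon>
    using assms(1) that by (simp add: has_frac_lap_def)
  have I1: "integrable lborel (frac_integrand \<alpha> u (x + h) \<epsilon>)" if "0 < \<epsilon>" for \<epsilon>
    using assms(2) that by (simp add: has_frac_lap_def)
  have I2: "integrable lborel (\<lambda>z. frac_integrand \<alpha> u (x + h) \<epsilon> (h + 1 * z))" if "0 < \<epsilon>" for \<epsilon>
    using I1[OF that] by (rule lborel_integrable_real_affine) simp
  have int: "(LINT z|lborel. frac_integrand \<alpha> (\<lambda>z. k * (u z - u (z + h))) x \<epsilon> z) =
      k * ((LINT z|lborel. frac_integrand \<alpha> u x \<epsilon> z) - (LINT z|lborel. frac_integrand \<alpha> u (x + h) \<epsilon> z))"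
    if "0 < \<epsilon>" for \<epsilon>
    using lborel_integral_real_affine[of 1 "frac_integrand \<alpha> u (x + h) \<epsilon>" h] I0[OF that] I2[OF that]
    unfolding eq by simp
  have "((\<lambda>\<epsilon>. k * (frac_const \<alpha> * (LINT z|lborel. frac_integrand \<alpha> u x \<epsilon> z)
      - frac_const \<alpha> * (LINT z|lborel. frac_integrand \<alpha> u (x + h) \<epsilon> z))) \<longlongrightarrow> k * (L0 - L1)) (at_right 0)"
    using assms by (intro tendsto_intros) (auto simp: has_frac_lap_def)
  then have "((\<lambda>\<epsilon>. frac_const \<alpha> * (LINT z|lborel. frac_integrand \<alpha> (\<lambda>z. k * (u z - u (z + h))) x \<epsilon> z))
      \<longlongrightarrow> k * (L0 - L1)) (at_right 0)"
  proof (rule Lim_transform_eventually)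
    show "\<forall>\<^sub>F \<epsilon> in at_right 0. k * (frac_const \<alpha> * (LINT z|lborel. frac_integrand \<alpha> u x \<epsilon> z)
        - frac_const \<alpha> * (LINT z|lborel. frac_integrand \<alpha> u (x + h) \<epsilon> z)) =
        frac_const \<alpha> * (LINT z|lborel. frac_integrand \<alpha> (\<lambda>z. k * (u z - u (z + h))) x \<epsilon> z)"
      using eventually_at_right_less[of 0]
    proof eventually_elim
      case (elim \<epsilon>)
      show ?case unfolding int[OF elim] by (simp add: right_diff_distrib mult.left_commute)
    qed
  qed
  moreover have "integrable lborel (frac_integrand \<alpha> (\<lambda>z. k * (u z - u (z + h))) x \<epsilon>)" if "0 < \<epsilon>" for \<epsilon>
    unfolding eq using I0[OF that] I2[OF that] by (intro integrable_mult_right Bochner_Integration.integrable_diff)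
  ultimately show ?thesis by (simp add: has_frac_lap_def)
qed

text \<open>Far to the left \<open>F\<close> stays below \<open>F x1\<close>, so the supremum is
  decided on a compact interval.\<close>

lemma continuous_attains_sup_at_bot:
  fixes F :: "real \<Rightarrow> real"
  assumes cont: "continuous_on {..b} F" and lim: "(F \<longlongrightarrow> l) at_bot"
    and x1: "x1 \<le> b" "l < F x1"
  obtains x0 where "x0 \<le> b" "\<And>x. x \<le> b \<Longrightarrow> F x \<le> F x0"
proof -
  have "eventually (\<lambda>x. F x < F x1) at_bot" using lim x1 by (simp add: order_tendstoD)
  then obtain R where R: "\<And>x. x \<le> R \<Longrightarrow> F x < F x1" by (auto simp: eventually_at_bot_linorder)
  define a where "a = min R x1"
  have "\<exists>x0\<in>{a..b}. \<forall>x\<in>{a..b}. F x \<le> F x0"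
    using x1 by (intro continuous_attains_sup continuous_on_subset[OF cont]) (auto simp: a_def)
  then obtain x0 where x0: "x0 \<in> {a..b}" "\<And>x. x \<in> {a..b} \<Longrightarrow> F x \<le> F x0" by blast
  have "F x \<le> F x0" if "x \<le> b" for x
  proof (cases "a \<le> x")
    case False
    then have "F x < F x1" by (intro R) (auto simp: a_def split: if_splits)
    also have "F x1 \<le> F x0" using x1 by (intro x0) (auto simp: a_def)
    finally show ?thesis by simp
  qed (use that x0 in auto)
  with x0 show thesis by (intro that[of x0]) auto
qed

lemma tendsto_powr_reflected_at_bot:
  fixes p :: real
  assumes "p < 0"
  shows "((\<lambda>x. (- x) powr p) \<longlongrightarrow> 0) at_bot"
  using tendsto_neg_powr[OF assms filterlim_uminus_at_top_at_bot] .

section \<open>Upper bound by comparison with a power\<close>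

lemma frac_drift_solution_upper_bound:
  fixes \<alpha> c :: real and u :: "real \<Rightarrow> real"
  assumes \<alpha>: "1/2 < \<alpha>" "\<alpha> < 1" and c: "0 < c"
    and le1: "\<And>x. u x \<le> 1"
    and nonneg: "\<And>x. 0 \<le> u x"
    and diff: "\<And>x. u differentiable (at x)"
    and lim: "(u \<longlongrightarrow> 0) at_bot"
    and eq: "\<And>x. x < 0 \<Longrightarrow> has_frac_lap \<alpha> u x (- (c * deriv u x))"
  shows "\<exists>M>0. \<forall>x<0. u x \<le> M * (- x) powr (1 - 2 * \<alpha>)"
proof -
  define p where "p = 2 * \<alpha> - 1"
  have p: "0 < p" "p < 1" using \<alpha> by (simp_all add: p_def)
  \<comment> \<open>Coefficient of \<open>y powr (- 2 * \<alpha>)\<close> in the loss of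
    \<open>frac_lap_lower_bound\<close> for \<open>r = y / 2\<close>,
    \<open>A = 3 / y\<^sup>2\<close> and \<open>D = 1\<close>; it does not involve
    \<open>M\<close>.\<close>
  define C where "C = 3 * (1/2) powr (2 - 2 * \<alpha>) / (2 - 2 * \<alpha>) + 2 * (1/2) powr (- 2 * \<alpha>) / (2 * \<alpha>)"
  have C: "0 < C" using \<alpha> unfolding C_def by (intro add_pos_pos) auto
  have fc: "0 < frac_const \<alpha>" using \<alpha> by (intro frac_const_pos) auto
  \<comment> \<open>Makes the drift coefficient \<open>c * (M * p)\<close> strictly larger than the
    nonlocal one, \<open>frac_const \<alpha> * C\<close>.\<close>
  define M where "M = frac_const \<alpha> * C / (c * p) + 1"
  have M: "1 \<le> M" "frac_const \<alpha> * C < c * (M * p)"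
    using C fc c p by (simp_all add: M_def field_simps)
  \<comment> \<open>The barrier \<open>g\<close> equals 1 at \<open>- y0\<close>. Between there and
    0 it is at least 1, hence above \<open>u\<close>, so a violation can only occur further
    left.\<close>
  define y0 where "y0 = M powr (1 / p)"
  have y0: "0 < y0" "M * y0 powr (- p) = 1"
    using M p by (simp_all add: y0_def powr_powr powr_minus)
  define g where "g = (\<lambda>x. M * (- x) powr (- p))"
  have g_ge: "1 \<le> g x" if "- y0 \<le> x" "x < 0" for x
  proof -
    have "y0 powr (- p) \<le> (- x) powr (- p)" using that p y0 by (intro powr_mono2') auto
    then have "M * y0 powr (- p) \<le> g x" unfolding g_def using M by (intro mult_left_mono) auto
    then show ?thesis using y0 by simp
  qed
  have "u x \<le> g x" if "x < 0" for x
  proof (rule ccontr)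
    assume "\<not> u x \<le> g x"
    then have x: "g x < u x" by simp
    have xy: "x \<le> - y0" using g_ge[of x] le1[of x] x that by force
    obtain x0 where x0: "x0 \<le> - y0" and max0: "\<And>z. z \<le> - y0 \<Longrightarrow> u z - g z \<le> u x0 - g x0"
    proof (rule continuous_attains_sup_at_bot[of "- y0" "\<lambda>x. u x - g x" 0 x])
      show "continuous_on {..- y0} (\<lambda>x. u x - g x)"
        unfolding g_def using y0
        by (intro continuous_intros differentiable_imp_continuous_on) (auto intro: diff differentiable_at_withinI simp: differentiable_on_def)
      have "((\<lambda>x. u x - g x) \<longlongrightarrow> 0 - M * 0) at_bot"
        unfolding g_def using p by (intro tendsto_intros lim tendsto_powr_reflected_at_bot) auto
      then show "((\<lambda>x. u x - g x) \<longlongrightarrow> 0) at_bot" by simp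
    qed (use x xy in auto)
    have pos: "g x0 < u x0" using max0[OF xy] x by simp
    \<comment> \<open>To the right of \<open>- y0\<close> the difference is nonpositive, hence below
      the positive maximum; so \<open>x0\<close> is maximal on the whole negative axis.\<close>
    have max: "u z - g z \<le> u x0 - g x0" if "z < 0" for z
      using max0[of z] g_ge[OF _ that] le1[of z] pos by force
    define y where "y = - x0"
    then have x0_eq: "x0 = - y" by simp
    have y: "0 < y" "y0 < y"
      using x0 y0 g_ge[of x0] pos le1[of x0] by (force simp: y_def)+
    have gy: "g x0 = M * y powr (- p)" by (simp add: g_def y_def)
    \<comment> \<open>At the contact point \<open>g x0 < u x0 \<le> 1\<close> absorbs the factor
      \<open>M\<close>, which keeps the constant for nearby second differences independent of
      \<open>M\<close>.\<close>
    have gle: "M * y powr (- p) \<le> 1" using pos le1[of x0] by (simp add: gy)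
    have "((\<lambda>x. u x - g x) has_real_derivative deriv u x0 - M * (- (- p) * (- x0) powr (- p - 1))) (at x0)"
      unfolding g_def using y diff[of x0]
      by (intro DERIV_diff DERIV_cmult has_real_derivative_powr_reflected)
         (auto simp: y_def DERIV_deriv_iff_real_differentiable)
    then have "deriv u x0 - M * (- (- p) * (- x0) powr (- p - 1)) = 0"
      by (rule DERIV_local_max[of _ _ _ y]) (use y in \<open>auto intro!: max simp: y_def\<close>)
    then have du: "deriv u x0 = M * p * y powr (- 2 * \<alpha>)" by (simp add: y_def p_def)
    have near: "u (x0 + t) + u (x0 - t) - 2 * u x0 \<le> 3 / y\<^sup>2 * t\<^sup>2" if t: "0 < t" "t < y / 2" for t
    proof -
      have "u (x0 + t) + u (x0 - t) - 2 * u x0 \<le> g (x0 + t) + g (x0 - t) - 2 * g x0"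
        using max[of "x0 + t"] max[of "x0 - t"] t y by (simp add: y_def)
      also have "\<dots> = M * ((y - t) powr (- p) + (y + t) powr (- p) - 2 * y powr (- p))"
        by (simp add: g_def x0_eq algebra_simps)
      also have "\<dots> \<le> M * (3 * y powr (- p) * (t / y)\<^sup>2)"
        using M p t by (intro mult_left_mono powr_neg_second_difference_le) auto
      also have "\<dots> = (M * y powr (- p)) * (3 * (t / y)\<^sup>2)" by simp
      also have "\<dots> \<le> 1 * (3 * (t / y)\<^sup>2)" using gle by (intro mult_right_mono) auto
      finally show ?thesis by (simp add: power_divide)
    qed
    have "frac_const \<alpha> * ((y/2) powr (- 1 - 2 * \<alpha>) * (LINT z::real|lborel. 0)
      - 3 / y\<^sup>2 * ((y/2) powr (2 - 2 * \<alpha>) / (2 - 2 * \<alpha>)) - 1 * (2 * (y/2) powr (- 2 * \<alpha>) / (2 * \<alpha>)))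
      \<le> - (c * deriv u x0)"
    proof (rule frac_lap_lower_bound[where E = "\<lambda>_. 0", OF _ _ eq])
      show "u z - u x0 \<le> 1 - 0" for z using le1[of z] nonneg[of x0] by simp
    qed (use \<alpha> y near in \<open>auto simp: y_def\<close>)
    then have "- (frac_const \<alpha> * (3 / y\<^sup>2 * ((y/2) powr (2 - 2 * \<alpha>) / (2 - 2 * \<alpha>)) + 2 * (y/2) powr (- 2 * \<alpha>) / (2 * \<alpha>)))
      \<le> - (c * deriv u x0)"
      by (simp add: right_diff_distrib distrib_left)
    moreover have "3 / y\<^sup>2 * ((y/2) powr (2 - 2 * \<alpha>) / (2 - 2 * \<alpha>)) + 2 * (y/2) powr (- 2 * \<alpha>) / (2 * \<alpha>)
       = C * y powr (- 2 * \<alpha>)"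
    proof -
      have "y powr (2 - 2 * \<alpha>) = y\<^sup>2 * y powr (- 2 * \<alpha>)"
        using powr_add[of y 2 "- 2 * \<alpha>"] y by simp
      moreover have "(y/2) powr a = y powr a * (1/2) powr a" for a
        using powr_mult[of y "1/2" a] y by simp
      ultimately show ?thesis using y by (simp add: C_def algebra_simps)
    qed
    ultimately have "c * (M * p * y powr (- 2 * \<alpha>)) \<le> frac_const \<alpha> * (C * y powr (- 2 * \<alpha>))"
      unfolding du by (simp only: neg_le_iff_le)
    then have "(c * (M * p)) * y powr (- 2 * \<alpha>) \<le> (frac_const \<alpha> * C) * y powr (- 2 * \<alpha>)"
      by (simp add: algebra_simps)
    then show False using M y by simp
  qed
  then show ?thesis using M by (intro exI[of _ M]) (auto simp: g_def p_def)
qed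

section \<open>Lower bound by a barrier fed by distant mass\<close>

text \<open>The constant \<open>m\<close> is chosen before \<open>v\<close>, so that one
  \<open>m\<close> serves the difference quotients of every step size. The equation is put for
  \<open>- v\<close> because the maximum principle asks for upper bounds on increments, and these
  hold for \<open>- v\<close> where \<open>m * b - v\<close> is maximal.\<close>

lemma frac_drift_solution_lower_bound:
  fixes \<alpha> c T Q :: real
  assumes \<alpha>: "1/2 < \<alpha>" "\<alpha> < 1" and c: "0 < c" and T: "0 \<le> T" and Q: "0 < Q"
  shows "\<exists>m>0. \<forall>v. (\<forall>x. 0 \<le> v x) \<longrightarrow> (\<forall>x. v differentiable (at x)) \<longrightarrow> (v \<longlongrightarrow> 0) at_bot \<longrightarrow>
     (\<forall>x. x < -1/2 \<longrightarrow> has_frac_lap \<alpha> (\<lambda>z. - v z) x (c * deriv v x)) \<longrightarrow>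
     Q \<le> (LINT z|lborel. indicator {0..T} z * v z) \<longrightarrow>
     (\<forall>x\<le>-1. m * (- x) powr (- 2 * \<alpha>) \<le> v x)"
proof -
  define s where "s = 2 * \<alpha>"
  have s: "1 < s" "s < 2" using \<alpha> by (simp_all add: s_def)
  \<comment> \<open>With this \<open>a\<close> the function \<open>b\<close> vanishes at -1/2 and is
    nonpositive from there to 0, where the comparison then follows from
    \<open>0 \<le> v\<close>.\<close>
  define a where "a = (1/2::real) powr (2 - s)"
  have a: "0 < a" "a < 1" using s powr_less_mono2[of "2 - s" "1/2" 1] by (simp_all add: a_def)
  \<comment> \<open>In units of \<open>y powr (- 1 - s)\<close>, \<open>C\<close> collects the
    losses per unit of \<open>m\<close> (drift, near and far parts), and \<open>k\<close> below is
    the gain from the mass \<open>Q\<close> on \<open>{0..T}\<close>. Taking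
    \<open>m = k / (2 * C)\<close> keeps the losses at half the gain.\<close>
  define C where "C = c * s + frac_const \<alpha> * (22 * (1/2) powr (2 - s) / (2 - s) + 4 * (1/2) powr (- s) / s)"
  have fc: "0 < frac_const \<alpha>" using \<alpha> by (intro frac_const_pos) auto
  have C: "0 < C" unfolding C_def using s c fc
    by (intro add_pos_pos mult_pos_pos divide_pos_pos) auto
  define k where "k = frac_const \<alpha> * Q * (1 + 2 * T) powr (- 1 - s)"
  have k: "0 < k" unfolding k_def using fc Q T by simp
  define m where "m = k / (2 * C)"
  have m: "0 < m" "m * C < k" using k C by (simp_all add: m_def)
  define b where "b = (\<lambda>x. (- x) powr (- s) - a * (- x) powr (- 2))"
  have b_split: "(- x) powr (- s) = (- x) powr (2 - s) * (- x) powr (- 2)" for x :: real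
    by (simp add: powr_add[symmetric])
  have b_nonpos: "b x \<le> 0" if "-1/2 \<le> x" "x < 0" for x
  proof -
    have "(- x) powr (2 - s) \<le> a" unfolding a_def using that s by (intro powr_mono2) auto
    then show ?thesis unfolding b_def b_split by (simp add: mult_right_mono)
  qed
  have b_ge: "(1 - a) * (- x) powr (- s) \<le> b x" if "x \<le> -1" for x
  proof -
    have "(- x) powr (- 2) \<le> (- x) powr (- s)" using that s by (intro powr_mono) auto
    then have "a * (- x) powr (- 2) \<le> a * (- x) powr (- s)" using a by (intro mult_left_mono) auto
    then show ?thesis by (simp add: b_def algebra_simps)
  qed
  have claim: "m * b x \<le> v x"
    if v_nonneg: "\<And>x. 0 \<le> v x" and diff: "\<And>x. v differentiable (at x)" and lim: "(v \<longlongrightarrow> 0) at_bot"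
      and eq: "\<And>x. x < -1/2 \<Longrightarrow> has_frac_lap \<alpha> (\<lambda>z. - v z) x (c * deriv v x)"
      and QE: "Q \<le> (LINT z|lborel. indicator {0..T} z * v z)"
      and x_le: "x \<le> -1/2" for v x
  proof (rule ccontr)
    assume "\<not> m * b x \<le> v x"
    then have x: "v x < m * b x" by simp
    obtain x0 where x0: "x0 \<le> -1/2" and max0: "\<And>z. z \<le> -1/2 \<Longrightarrow> m * b z - v z \<le> m * b x0 - v x0"
    proof (rule continuous_attains_sup_at_bot[of "-1/2" "\<lambda>x. m * b x - v x" 0 x])
      show "continuous_on {..-1/2} (\<lambda>x. m * b x - v x)"
        unfolding b_def
        by (intro continuous_intros differentiable_imp_continuous_on) (auto intro: diff differentiable_at_withinI simp: differentiable_on_def)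
      have "((\<lambda>x. m * b x - v x) \<longlongrightarrow> m * (0 - a * 0) - 0) at_bot"
        unfolding b_def using s by (intro tendsto_intros lim tendsto_powr_reflected_at_bot) auto
      then show "((\<lambda>x. m * b x - v x) \<longlongrightarrow> 0) at_bot" by simp
    qed (use x x_le in auto)
    have pos: "v x0 < m * b x0" using max0[OF x_le] x by simp
    have b_neg: "m * b z \<le> v z" if "-1/2 \<le> z" "z < 0" for z
      using mult_left_mono[OF b_nonpos[OF that], of m] m v_nonneg[of z] by simp
    have max: "m * b z - v z \<le> m * b x0 - v x0" if "z < 0" for z
      using max0[of z] b_neg[of z] that pos by force
    define y where "y = - x0"
    then have x0_eq: "x0 = - y" by simp
    have y: "1/2 < y" using x0 b_neg[of x0] pos by (force simp: y_def)
    have b0: "b x0 \<le> y powr (- s)" using a by (simp add: b_def y_def)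
    have "((\<lambda>x. m * b x - v x) has_real_derivative
        m * (- (- s) * (- x0) powr (- s - 1) - a * (- (- 2) * (- x0) powr (- 2 - 1))) - deriv v x0) (at x0)"
      unfolding b_def using y diff[of x0]
      by (intro DERIV_diff DERIV_cmult has_real_derivative_powr_reflected)
         (auto simp: y_def DERIV_deriv_iff_real_differentiable)
    then have "m * (- (- s) * (- x0) powr (- s - 1) - a * (- (- 2) * (- x0) powr (- 2 - 1))) - deriv v x0 = 0"
      by (rule DERIV_local_max[of _ _ _ y]) (use y in \<open>auto intro!: max simp: y_def\<close>)
    then have "deriv v x0 = m * (s * y powr (- 1 - s) - 2 * a * y powr (- 3))"
      by (simp add: y_def right_diff_distrib mult.assoc minus_diff_commute)
    also have "\<dots> \<le> m * (s * y powr (- 1 - s))"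
      using m a by (intro mult_left_mono) auto
    finally have dv: "deriv v x0 \<le> m * s * y powr (- 1 - s)" by simp
    have near: "- v (x0 + t) + - v (x0 - t) - 2 * - v x0 \<le> 11 * m / y ^ 4 * t\<^sup>2"
      if t: "0 < t" "t < y / 2" for t
    proof -
      have "- v (x0 + t) + - v (x0 - t) - 2 * - v x0 \<le> m * (2 * b x0 - b (x0 + t) - b (x0 - t))"
        using max[of "x0 + t"] max[of "x0 - t"] t y by (simp add: y_def algebra_simps)
      \<comment> \<open>The convex power \<open>y powr (- s)\<close> enters with the favourable
        sign; only the subtracted inverse square costs anything, with weight
        \<open>a < 1\<close>.\<close>
      also have "2 * b x0 - b (x0 + t) - b (x0 - t) =
         (2 * y powr (- s) - ((y - t) powr (- s) + (y + t) powr (- s)))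
         + a * (1 / (y - t)\<^sup>2 + 1 / (y + t)\<^sup>2 - 2 / y\<^sup>2)"
        using t y by (simp add: b_def x0_eq algebra_simps powr_minus_divide)
      also have "\<dots> \<le> 0 + 1 * (11 / y ^ 4 * t\<^sup>2)"
        using t y s a powr_neg_second_difference_nonneg[of t y s] inverse_square_second_difference_le[of t y]
        by (intro add_mono order_trans[OF mult_left_mono mult_right_mono]) auto
      finally show ?thesis using m by (simp add: mult_left_mono algebra_simps)
    qed
    define E where "E = (\<lambda>z. indicator {0..T} z * v z)"
    have "frac_const \<alpha> * ((y + T) powr (- 1 - 2 * \<alpha>) * (LINT z|lborel. E z)
      - 11 * m / y ^ 4 * ((y/2) powr (2 - 2 * \<alpha>) / (2 - 2 * \<alpha>))
      - (m * y powr (- s)) * (2 * (y/2) powr (- 2 * \<alpha>) / (2 * \<alpha>)))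
      \<le> c * deriv v x0"
    proof (rule frac_lap_lower_bound[OF _ _ eq])
      \<comment> \<open>A non-integrable function would have integral 0 by default, contradicting
        \<open>0 < Q\<close>.\<close>
      show "integrable lborel E"
        using QE Q not_integrable_integral_eq[of lborel E] by (force simp: E_def)
      have "v x0 \<le> m * y powr (- s)" using pos mult_left_mono[OF b0, of m] m by linarith
      then show "- v z - - v x0 \<le> m * y powr (- s) - E z" for z
        using v_nonneg[of z] by (auto simp: E_def indicator_def)
      show "y / 2 \<le> \<bar>z - x0\<bar> \<and> \<bar>z - x0\<bar> \<le> y + T" if "E z \<noteq> 0" for z
        using that y by (auto simp: E_def indicator_def y_def split: if_splits)
    qed (use \<alpha> y m near v_nonneg in \<open>auto simp: y_def E_def\<close>)
    then have main: "frac_const \<alpha> * ((y + T) powr (- 1 - s) * (LINT z|lborel. E z)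
      - 11 * m / y ^ 4 * ((y/2) powr (2 - s) / (2 - s))
      - (m * y powr (- s)) * (2 * (y/2) powr (- s) / s)) \<le> c * deriv v x0"
      by (simp add: s_def)
    define Y where "Y = y powr (- 1 - s)"
    have Y: "0 < Y" using y by (simp add: Y_def)
    have half: "(y/2) powr e = y powr e * (1/2) powr e" for e
      using powr_mult[of y "1/2" e] y by simp
    have gain: "Q * (1 + 2 * T) powr (- 1 - s) * Y \<le> (y + T) powr (- 1 - s) * (LINT z|lborel. E z)"
    proof -
      \<comment> \<open>Uses \<open>1/2 < y\<close>, so that
        \<open>T \<le> 2 * y * T\<close>.\<close>
      have "y + T \<le> y * (1 + 2 * T)" using y T mult_right_mono[of 1 "2 * y" T] by (simp add: algebra_simps)
      then have "(y * (1 + 2 * T)) powr (- 1 - s) \<le> (y + T) powr (- 1 - s)"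
        using y T s by (intro powr_mono2') auto
      then have "(1 + 2 * T) powr (- 1 - s) * Y \<le> (y + T) powr (- 1 - s)"
        using y T by (simp add: powr_mult Y_def mult.commute)
      then have "((1 + 2 * T) powr (- 1 - s) * Y) * Q \<le> (y + T) powr (- 1 - s) * (LINT z|lborel. E z)"
        using QE Q Y by (intro mult_mono) (auto simp: E_def)
      then show ?thesis by (simp add: algebra_simps)
    qed
    \<comment> \<open>The two losses decay like \<open>y powr (- 2 - s)\<close> and
      \<open>y powr (- 2 * s)\<close>; both powers are at most \<open>2 * Y\<close>, since
      \<open>1/2 < y\<close> and \<open>1 < s < 2\<close>.\<close>
    have loss1: "11 * m / y ^ 4 * ((y/2) powr (2 - s) / (2 - s)) \<le> m * (22 * (1/2) powr (2 - s) / (2 - s)) * Y"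
    proof -
      have "y powr (2 - s) = y ^ 3 * Y"
        using powr_add[of y 3 "- 1 - s"] y by (simp add: Y_def)
      then have "y powr (2 - s) / y ^ 4 = Y / y"
        using y by (simp add: eval_nat_numeral field_simps)
      also have "\<dots> \<le> 2 * Y" using y Y mult_right_mono[of 1 "2 * y" Y] by (simp add: field_simps)
      finally have "11 * m * ((1/2) powr (2 - s) / (2 - s)) * (y powr (2 - s) / y ^ 4)
          \<le> 11 * m * ((1/2) powr (2 - s) / (2 - s)) * (2 * Y)"
        using m s by (intro mult_left_mono) auto
      then show ?thesis unfolding half by (simp add: algebra_simps)
    qed
    have loss2: "(m * y powr (- s)) * (2 * (y/2) powr (- s) / s) \<le> m * (4 * (1/2) powr (- s) / s) * Y"
    proof -
      have "y powr (- s) * y powr (- s) = y powr (1 - s) * Y"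
        by (simp add: Y_def powr_add[symmetric])
      moreover have "y powr (1 - s) \<le> 2"
      proof -
        have "y powr (1 - s) \<le> (1/2) powr (1 - s)" using y s by (intro powr_mono2') auto
        also have "\<dots> = 2 powr (s - 1)" by (simp add: powr_divide powr_minus_divide[symmetric])
        also have "\<dots> \<le> 2 powr 1" using s by (intro powr_mono) auto
        finally show ?thesis by simp
      qed
      ultimately have "y powr (- s) * y powr (- s) \<le> 2 * Y" using Y by simp
      then have "(2 * m * (1/2) powr (- s) / s) * (y powr (- s) * y powr (- s)) \<le> (2 * m * (1/2) powr (- s) / s) * (2 * Y)"
        using m s by (intro mult_left_mono) auto
      then show ?thesis unfolding half by (simp add: algebra_simps)
    qed
    have "frac_const \<alpha> * (Q * (1 + 2 * T) powr (- 1 - s) * Y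
       - m * (22 * (1/2) powr (2 - s) / (2 - s)) * Y - m * (4 * (1/2) powr (- s) / s) * Y) \<le> c * (m * s * Y)"
      (is "_ * ?Z \<le> _")
    proof -
      have "frac_const \<alpha> * ?Z \<le> c * deriv v x0"
        using gain loss1 loss2 fc by (intro order_trans[OF mult_left_mono main]) auto
      also have "\<dots> \<le> c * (m * s * Y)" using dv c by (intro mult_left_mono) (auto simp: Y_def)
      finally show ?thesis .
    qed
    then have "k * Y \<le> (m * C) * Y" unfolding k_def C_def by (simp add: algebra_simps)
    then show False using Y m by simp
  qed
  \<comment> \<open>For \<open>x \<le> -1\<close> the barrier retains the fraction
    \<open>1 - a\<close> of the leading power.\<close>
  have "m * (1 - a) * (- x) powr (- 2 * \<alpha>) \<le> v x"
    if "\<forall>x. 0 \<le> v x" "\<forall>x. v differentiable (at x)" "(v \<longlongrightarrow> 0) at_bot"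
      "\<forall>x. x < -1/2 \<longrightarrow> has_frac_lap \<alpha> (\<lambda>z. - v z) x (c * deriv v x)"
      "Q \<le> (LINT z|lborel. indicator {0..T} z * v z)" "x \<le> -1" for v x
  proof -
    have "m * (1 - a) * (- x) powr (- 2 * \<alpha>) \<le> m * b x"
      using b_ge[OF \<open>x \<le> -1\<close>] m by (simp add: s_def mult.assoc)
    also have "\<dots> \<le> v x" using that by (intro claim) auto
    finally show ?thesis .
  qed
  then show ?thesis using m a by (intro exI[of _ "m * (1 - a)"]) auto
qed

section \<open>Difference quotients of a monotone function\<close>

text \<open>The integral telescopes to the mean of \<open>u\<close> over \<open>{T..T + h}\<close>
  minus its mean over \<open>{0..h}\<close>; monotonicity bounds these by \<open>u T\<close> from
  below and \<open>u h\<close> from above.\<close>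

lemma integral_shift_diff_ge:
  fixes u :: "real \<Rightarrow> real"
  assumes mono: "mono u" and cont: "continuous_on UNIV u" and h: "0 < h" "h \<le> T"
  shows "u T - u h \<le> (LINT z|lborel. indicator {0..T} z * ((u (z + h) - u z) / h))"
proof -
  have cont': "continuous_on S u" for S using cont by (rule continuous_on_subset) simp
  have int: "u integrable_on {a..b}" for a b
    by (intro integrable_continuous_interval cont')
  have "continuous_on {0..T} (u \<circ> (\<lambda>z. z + h))"
    by (intro continuous_on_compose continuous_intros cont')
  then have cont_sh: "continuous_on {0..T} (\<lambda>z. u (z + h))" by (simp add: o_def)
  have shift: "integral {0..T} (\<lambda>z. u (z + h)) = integral {h..T + h} u"
    using integral_shift[of 0 h T u] cont' by (simp add: o_def)
  have lower: "h * u T \<le> integral {T..T + h} u"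
    using integral_le[OF integrable_const_ivl int, of T "T + h" "u T"] h monoD[OF mono] by simp
  have upper: "integral {0..h} u \<le> h * u h"
    using integral_le[OF int integrable_const_ivl, of 0 h "u h"] h monoD[OF mono] by simp
  have "integral {0..h} u + integral {h..T} u = integral {0..T} u"
    "integral {h..T} u + integral {T..T + h} u = integral {h..T + h} u"
    using h int by (auto intro!: Henstock_Kurzweil_Integration.integral_combine)
  with lower upper have "h * (u T - u h) \<le> integral {0..T} (\<lambda>z. u (z + h)) - integral {0..T} u"
    by (simp add: shift algebra_simps)
  also have "\<dots> = integral {0..T} (\<lambda>z. u (z + h) - u z)"
    by (intro Henstock_Kurzweil_Integration.integral_diff[symmetric] int integrable_continuous_interval cont_sh)
  finally have "u T - u h \<le> integral {0..T} (\<lambda>z. u (z + h) - u z) / h"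
    using h by (simp add: field_simps)
  also have "\<dots> = integral {0..T} (\<lambda>z. (u (z + h) - u z) / h)"
    by simp
  also have "\<dots> = (LINT z:{0..T}|lborel. (u (z + h) - u z) / h)"
    using h by (intro set_borel_integral_eq_integral(2)[symmetric] borel_integrable_compact[unfolded set_integrable_def[symmetric]]
       borel_integrable_atLeastAtMost' continuous_intros cont_sh cont') auto
  finally show ?thesis by (simp add: set_lebesgue_integral_def)
qed

lemma has_real_derivative_difference_quotient:
  fixes u :: "real \<Rightarrow> real"
  assumes "\<And>x. u differentiable (at x)"
  shows "((\<lambda>x. (u (x + h) - u x) / h) has_real_derivative (deriv u (x + h) - deriv u x) / h) (at x)"
proof -
  have D: "(u has_real_derivative deriv u x) (at x)" for x
    using assms by (simp add: DERIV_deriv_iff_real_differentiable)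
  have "((\<lambda>x. u (x + h)) has_real_derivative deriv u (x + h)) (at x)"
    using D[of "x + h"] by (simp only: DERIV_shift)
  then show ?thesis by (intro DERIV_cdivide DERIV_diff D)
qed

section \<open>The barriers applied to the profile and its difference quotients\<close>

theorem theorem1p2:
  fixes \<alpha> \<theta> c0 f' :: real and f \<phi>0 :: "real \<Rightarrow> real"
  assumes alpha: "1/2 < \<alpha>" "\<alpha> < 1"
    and theta: "0 < \<theta>" "\<theta> < 1"
    and f_cont: "continuous_on UNIV f"
    and f_nonneg: "\<And>s. f s \<ge> 0"
    and f_supp: "closure {s. f s \<noteq> 0} = {\<theta>..1}"
    and f_deriv1: "(f has_real_derivative f') (at_left 1)" and f'_neg: "f' < 0"
    and c0_pos: "c0 > 0"
    and phi_mono: "mono \<phi>0"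
    and phi_diff: "\<And>x. \<phi>0 differentiable (at x)"
    and phi_eq: "\<And>x. has_frac_lap \<alpha> \<phi>0 x (f (\<phi>0 x) - c0 * deriv \<phi>0 x)"
    and phi_lim_bot: "(\<phi>0 \<longlongrightarrow> 0) at_bot"
    and phi_lim_top: "(\<phi>0 \<longlongrightarrow> 1) at_top"
    and phi_norm: "\<phi>0 0 = \<theta>"
  shows "\<exists>m M. m > 0 \<and> M > 0 \<and>
           (\<forall>x\<le>-1. \<phi>0 x \<le> M / \<bar>x\<bar> powr (2 * \<alpha> - 1) \<and>
                    deriv \<phi>0 x \<ge> m / \<bar>x\<bar> powr (2 * \<alpha>))"
proof -
  have f_left: "f s = 0" if "s < \<theta>" for s
    using f_supp closure_subset[of "{s. f s \<noteq> 0}"] that by force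
  \<comment> \<open>The support gives zeros of \<open>f\<close> strictly below
    \<open>\<theta>\<close>; continuity from the left adds the endpoint, the value of
    \<open>\<phi>0\<close> at 0.\<close>
  have "(f \<longlongrightarrow> f \<theta>) (at_left \<theta>)"
    using f_cont by (metis UNIV_I continuous_on_def filterlim_at_split open_UNIV continuous_on_eq_continuous_at isCont_def)
  moreover have "(f \<longlongrightarrow> 0) (at_left \<theta>)"
    by (rule tendsto_eventually) (auto simp: eventually_at_left_field f_left intro: exI[of _ "\<theta> - 1"])
  ultimately have "f \<theta> = 0" using tendsto_unique by (metis trivial_limit_at_left_real)
  with f_left have f0: "f s = 0" if "s \<le> \<theta>" for s using that by (cases "s = \<theta>") auto
  have eq: "has_frac_lap \<alpha> \<phi>0 x (- (c0 * deriv \<phi>0 x))" if "x \<le> 0" for x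
    using phi_eq[of x] f0[of "\<phi>0 x"] monoD[OF phi_mono that] phi_norm by simp
  have nonneg: "0 \<le> \<phi>0 x" for x
    by (rule tendsto_upperbound[OF phi_lim_bot])
       (auto simp: eventually_at_bot_linorder intro!: exI[of _ x] monoD[OF phi_mono])
  have le1: "\<phi>0 x \<le> 1" for x
    by (rule tendsto_lowerbound[OF phi_lim_top])
       (auto simp: eventually_at_top_linorder intro!: exI[of _ x] monoD[OF phi_mono])
  have cont: "continuous_on UNIV \<phi>0"
    using phi_diff by (simp add: differentiable_imp_continuous_on differentiable_on_def)
  obtain M where M: "0 < M" "\<And>x. x < 0 \<Longrightarrow> \<phi>0 x \<le> M * (- x) powr (1 - 2 * \<alpha>)"
    using frac_drift_solution_upper_bound[OF alpha c0_pos le1 nonneg phi_diff phi_lim_bot] eq by auto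
  \<comment> \<open>Leaves room for \<open>\<phi>0 T > \<theta> + 2 * d\<close> at some
    \<open>T\<close> and \<open>\<phi>0 h < \<theta> + d\<close> for small \<open>h\<close>. The
    difference quotients then have mass at least \<open>d\<close> on \<open>{0..T}\<close>,
    uniformly in \<open>h\<close>.\<close>
  define d where "d = (1 - \<theta>) / 4"
  have d: "0 < d" "\<theta> + 2 * d < 1" using theta by (auto simp: d_def field_simps)
  have "eventually (\<lambda>x. \<theta> + 2 * d < \<phi>0 x \<and> 1 \<le> x) at_top"
    using order_tendstoD(1)[OF phi_lim_top d(2)] eventually_ge_at_top[of 1] by (rule eventually_conj)
  then obtain T where T: "\<theta> + 2 * d < \<phi>0 T" "1 \<le> T" by (auto simp: eventually_at_top_linorder)
  have "isCont \<phi>0 0" using cont by (simp add: continuous_on_eq_continuous_at)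
  then have "(\<phi>0 \<longlongrightarrow> \<theta>) (at_right 0)"
    using phi_norm by (simp add: isCont_def filterlim_at_split)
  then have "eventually (\<lambda>h. \<phi>0 h < \<theta> + d) (at_right 0)"
    using d by (intro order_tendstoD(2)) auto
  then obtain h0 where h0: "0 < h0" "\<And>h. 0 < h \<Longrightarrow> h < h0 \<Longrightarrow> \<phi>0 h < \<theta> + d"
    by (auto simp: eventually_at_right_field)
  obtain m where m: "0 < m" and m_le: "\<And>v x. \<lbrakk>\<And>x. 0 \<le> v x; \<And>x. v differentiable (at x); (v \<longlongrightarrow> 0) at_bot;
     \<And>x. x < -1/2 \<Longrightarrow> has_frac_lap \<alpha> (\<lambda>z. - v z) x (c0 * deriv v x);
     d \<le> (LINT z|lborel. indicator {0..T} z * v z); x \<le> -1\<rbrakk> \<Longrightarrow> m * (- x) powr (- 2 * \<alpha>) \<le> v x"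
    using frac_drift_solution_lower_bound[OF alpha c0_pos _ d(1), of T] T by auto
  \<comment> \<open>The condition \<open>h < 1/2\<close> keeps \<open>x + h\<close> negative for
    \<open>x < -1/2\<close>, so the linear equation holds at both points of the quotient.\<close>
  have quotient: "m * (- x) powr (- 2 * \<alpha>) \<le> (\<phi>0 (x + h) - \<phi>0 x) / h"
    if x: "x \<le> -1" and h: "0 < h" "h < h0" "h < 1/2" for x h
  proof (rule m_le[OF _ _ _ _ _ x])
    note D = has_real_derivative_difference_quotient[OF phi_diff]
    show "0 \<le> (\<phi>0 (x + h) - \<phi>0 x) / h" for x using monoD[OF phi_mono, of x "x + h"] h by simp
    show "(\<lambda>x. (\<phi>0 (x + h) - \<phi>0 x) / h) differentiable (at x)" for x
      using D real_differentiable_def by blast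
    have "filterlim (\<lambda>x::real. x + h) at_bot at_bot"
      unfolding filterlim_at_bot eventually_at_bot_linorder by (metis le_diff_eq)
    then have "((\<lambda>x. (\<phi>0 (x + h) - \<phi>0 x) / h) \<longlongrightarrow> (0 - 0) / h) at_bot"
      using h by (intro tendsto_divide tendsto_diff tendsto_const phi_lim_bot filterlim_compose[OF phi_lim_bot]) auto
    then show "((\<lambda>x. (\<phi>0 (x + h) - \<phi>0 x) / h) \<longlongrightarrow> 0) at_bot" by simp
    show "has_frac_lap \<alpha> (\<lambda>z. - ((\<phi>0 (z + h) - \<phi>0 z) / h)) x (c0 * deriv (\<lambda>x. (\<phi>0 (x + h) - \<phi>0 x) / h) x)"
      if "x < -1/2" for x
      unfolding DERIV_imp_deriv[OF D]
      using has_frac_lap_shift_diff[OF eq eq, of x h "1 / h"] that h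
      by (simp add: diff_divide_distrib right_diff_distrib)
    have "d \<le> \<phi>0 T - \<phi>0 h" using h0(2)[of h] h T by simp
    also have "\<dots> \<le> (LINT z|lborel. indicator {0..T} z * ((\<phi>0 (z + h) - \<phi>0 z) / h))"
      using h T by (intro integral_shift_diff_ge phi_mono cont) auto
    finally show "d \<le> (LINT z|lborel. indicator {0..T} z * ((\<phi>0 (z + h) - \<phi>0 z) / h))" .
  qed
  \<comment> \<open>As \<open>m\<close> does not depend on \<open>h\<close>, the bound survives the
    limit of \<open>h\<close> to 0 from the right.\<close>
  have "m * (- x) powr (- 2 * \<alpha>) \<le> deriv \<phi>0 x" if x: "x \<le> -1" for x
  proof (rule tendsto_lowerbound)
    have "(\<phi>0 has_real_derivative deriv \<phi>0 x) (at x)"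
      using phi_diff by (simp add: DERIV_deriv_iff_real_differentiable)
    then show "((\<lambda>h. (\<phi>0 (x + h) - \<phi>0 x) / h) \<longlongrightarrow> deriv \<phi>0 x) (at_right 0)"
      by (simp add: DERIV_def filterlim_at_split)
    show "eventually (\<lambda>h. m * (- x) powr (- 2 * \<alpha>) \<le> (\<phi>0 (x + h) - \<phi>0 x) / h) (at_right 0)"
      using quotient[OF x] h0(1) by (auto simp: eventually_at_right_field intro!: exI[of _ "min h0 (1/2)"])
  qed simp
  then show ?thesis
    using m M by (intro exI[of _ m] exI[of _ M])
      (auto simp: powr_minus_divide[symmetric] divide_inverse powr_minus[symmetric])
qed

end
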